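(* Let $n\ge 1$, let $a_1,\dots,a_n,b\in\mathbb{Q}$ with $0<a_i\le b$ for all $i$ and $\sum_{i=1}^n a_i>b$, let $\alpha_1,\dots,\alpha_n\in\mathbb{R}$, and let $k\in\{1,\dots,n\}$. For $z\in[0,b]$ let $$F_k(z)=\max_{\boldsymbol{x}\in\{0,1\}^k}\Big\{\sum_{i=1}^k\alpha_i x_i:\ \sum_{i=1}^k a_i x_i\le z\Big\}.$$ Let $L_k=\{(w^j,p^j)\}_{j=1}^m$ be the dominance list associated with $(a_i,\alpha_i)_{i=1}^k$, with its states ordered so that $w^j<w^{j+1}$ and $p^j<p^{j+1}$ for all $j=1,\dots,m-1$. Then, for any $\bar z\in[0,b]$, $$F_k(\bar z)=\begin{cases}p^j,&\text{if }\bar z\in[w^j,w^{j+1}),\ j=1,\dots,m-1,\\ p^m,&\text{if }\bar z\in[w^m,b].\end{cases}$$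
   Context: The list of all states is the finite set $$\bar L_k=\Big\{(w,p):\ w=\sum_{i=1}^k a_i x_i,\ p=\sum_{i=1}^k\alpha_i x_i\ \text{for some } \boldsymbol{x}\in\{0,1\}^k\Big\}.$$ A state $(w',p')\in\bar L_k$ dominates a state $(w'',p'')\in\bar L_k$ if ($w'<w''$ and $p'\ge p''$) or ($w'\le w''$ and $p'>p''$). The dominance list $L_k$ is the set of those states of $\bar L_k$ that are not dominated by any state of $\bar L_k$. Any two distinct states of $L_k$ are strictly ordered in both coordinates (in the same direction), so $L_k$ can be enumerated with $w^j$ and $p^j$ both strictly increasing in $j$; $m$ denotes the number of its states. If $w^m>b$, the interval $[w^m,b]$ is empty. *)

theory Defs
  imports Complex_Main "HOL-Library.FuncSet"
begin

definition binary_vectors :: "nat \<Rightarrow> (nat \<Rightarrow> real) set" where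
  "binary_vectors k = {1..k} \<rightarrow>\<^sub>E {0, 1}"

(* Max is meant for finite nonempty sets; the set below is always finite, and it is
   nonempty for z \<ge> 0 because it contains the value of the zero vector. *)
definition knapsack_value ::
  "(nat \<Rightarrow> real) \<Rightarrow> (nat \<Rightarrow> real) \<Rightarrow> nat \<Rightarrow> real \<Rightarrow> real" where
  "knapsack_value a \<alpha> k z =
     Max {(\<Sum>i=1..k. \<alpha> i * x i) | x. x \<in> binary_vectors k \<and> (\<Sum>i=1..k. a i * x i) \<le> z}"

definition all_states ::
  "(nat \<Rightarrow> real) \<Rightarrow> (nat \<Rightarrow> real) \<Rightarrow> nat \<Rightarrow> (real \<times> real) set" where
  "all_states a \<alpha> k =
     {(w, p). \<exists>x \<in> binary_vectors k. w = (\<Sum>i=1..k. a i * x i) \<and> p = (\<Sum>i=1..k. \<alpha> i * x i)}"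

definition dominates :: "real \<times> real \<Rightarrow> real \<times> real \<Rightarrow> bool" where
  "dominates s t \<longleftrightarrow>
     (fst s < fst t \<and> snd s \<ge> snd t) \<or> (fst s \<le> fst t \<and> snd s > snd t)"

definition dominance_list ::
  "(nat \<Rightarrow> real) \<Rightarrow> (nat \<Rightarrow> real) \<Rightarrow> nat \<Rightarrow> (real \<times> real) set" where
  "dominance_list a \<alpha> k =
     {t \<in> all_states a \<alpha> k. \<not> (\<exists>s \<in> all_states a \<alpha> k. dominates s t)}"

(* States are ordered pairs (w, p), indexed from 1. *)
definition increasing_enumeration ::
  "(real \<times> real) set \<Rightarrow> nat \<Rightarrow> (nat \<Rightarrow> real) \<Rightarrow> (nat \<Rightarrow> real) \<Rightarrow> bool" where
  "increasing_enumeration L m w p \<longleftrightarrow>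
     m = card L \<and> L = {(w j, p j) | j. j \<in> {1..m}} \<and>
     (\<forall>j \<in> {1..<m}. w j < w (j + 1) \<and> p j < p (j + 1))"

lemma finite_dominance_list: "finite (dominance_list a \<alpha> k)"
proof -
  have "all_states a \<alpha> k =
      (\<lambda>x. (\<Sum>i=1..k. a i * x i, \<Sum>i=1..k. \<alpha> i * x i)) ` binary_vectors k"
    by (auto simp: all_states_def)
  moreover have "finite (binary_vectors k)"
    by (simp add: binary_vectors_def finite_PiE)
  ultimately show ?thesis
    by (simp add: dominance_list_def)
qed

lemma dominance_list_ordered:
  assumes "s \<in> dominance_list a \<alpha> k" "t \<in> dominance_list a \<alpha> k" "s \<noteq> t"
  shows "(fst s < fst t \<and> snd s < snd t) \<or> (fst t < fst s \<and> snd t < snd s)"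
proof -
  have "\<not> dominates s t" "\<not> dominates t s"
    using assms by (auto simp: dominance_list_def)
  with assms(3) show ?thesis
    by (auto simp: dominates_def prod_eq_iff)
qed

(* The assumption that w and p enumerate the dominance list can always be satisfied. *)
lemma increasing_enumeration_exists:
  "\<exists>w p. increasing_enumeration (dominance_list a \<alpha> k) (card (dominance_list a \<alpha> k)) w p"
proof -
  define L where "L = dominance_list a \<alpha> k"
  have ordered: "fst s < fst t \<and> snd s < snd t \<or> fst t < fst s \<and> snd t < snd s"
    if "s \<in> L" "t \<in> L" "s \<noteq> t" for s t
    using dominance_list_ordered that unfolding L_def by blast
  have inj: "inj_on fst L"
    proof (rule inj_onI, rule ccontr)
    fix s t
    assume "s \<in> L" "t \<in> L" "fst s = fst t" "s \<noteq> t"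
    then show False
      using ordered[of s t] by simp
  qed
  define ws where "ws = sorted_list_of_set (fst ` L)"
  have fin: "finite (fst ` L)"
    using finite_dominance_list by (simp add: L_def)
  have set: "set ws = fst ` L" and len: "length ws = card L"
    using fin inj by (simp_all add: ws_def card_image)
  define s where "s j = inv_into L fst (ws ! (j - 1))" for j
  have nth_in: "ws ! (j - 1) \<in> fst ` L" if "j \<in> {1..card L}" for j
  proof -
    have "j - 1 < length ws"
      using that len by auto
    then show ?thesis
      using set nth_mem by blast
  qed
  have sL: "s j \<in> L" and fs: "fst (s j) = ws ! (j - 1)" if "j \<in> {1..card L}" for j
    using inv_into_into[OF nth_in[OF that]] f_inv_into_f[OF nth_in[OF that]]
    by (simp_all only: s_def)
  have "t \<in> s ` {1..card L}" if "t \<in> L" for t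
  proof -
    have "fst t \<in> set ws"
      unfolding set using that by (rule imageI)
    then obtain i where i: "i < card L" "ws ! i = fst t"
      unfolding in_set_conv_nth len by blast
    have "s (Suc i) = t"
      unfolding s_def using i(2) inv_into_f_f[OF inj that] by simp
    then show ?thesis
      using i(1) by (intro image_eqI[of _ _ "Suc i"]) simp_all
  qed
  then have "L = s ` {1..card L}"
    using sL by auto
  then have "L = {(fst (s j), snd (s j)) | j. j \<in> {1..card L}}"
    unfolding prod.collapse Setcompr_eq_image by simp
  moreover have "fst (s j) < fst (s (j + 1)) \<and> snd (s j) < snd (s (j + 1))"
    if j: "j \<in> {1..<card L}" for j
  proof -
    have "ws ! (j - 1) < ws ! j"
    proof (rule sorted_wrt_nth_less)
      show "sorted_wrt (<) ws"
        unfolding ws_def by (rule strict_sorted_list_of_set)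
    qed (use j len in auto)
    then have less: "fst (s j) < fst (s (j + 1))"
      using j by (simp add: fs)
    have "s j \<in> L" "s (j + 1) \<in> L"
      using j by (simp_all add: sL)
    then show ?thesis
      using ordered[of "s j" "s (j + 1)"] less by (cases "s j = s (j + 1)") simp_all
  qed
  ultimately have "increasing_enumeration L (card L) (\<lambda>j. fst (s j)) (\<lambda>j. snd (s j))"
    unfolding increasing_enumeration_def by simp
  then show ?thesis
    unfolding L_def by blast
qed

end

theory Submission
  imports Defs
begin

text \<open>
  A finite set of states is covered by its undominated states: each state has an undominated one
  that is at most as heavy and at least as profitable
  (\<open>undominated_state_covers\<close>). Hence the best profit attainable with capacity
  \<open>z\<close> is already attained on the dominance list. Since profits increase along
  that list together with the weights, it is the profit of the last listed state that fits into
  \<open>z\<close> (\<open>knapsack_value_last_fitting\<close>), and the two cases of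
  the formula say which state this is. Some listed state always fits when \<open>z \<ge> 0\<close>:
  the one that covers the state of the zero vector.
\<close>

lemma all_states_image:
  "all_states a \<alpha> k =
     (\<lambda>x. (\<Sum>i=1..k. a i * x i, \<Sum>i=1..k. \<alpha> i * x i)) ` binary_vectors k"
  by (auto simp: all_states_def)

lemma finite_all_states: "finite (all_states a \<alpha> k)"
  unfolding all_states_image by (simp add: binary_vectors_def finite_PiE)

lemma zero_state: "(0, 0) \<in> all_states a \<alpha> k"
proof -
  have "(\<lambda>i\<in>{1..k}. 0) \<in> binary_vectors k"
    by (auto simp: binary_vectors_def)
  then show ?thesis
    unfolding all_states_image by (rule image_eqI[rotated]) simp
qed

lemma knapsack_value_all_states:
  "knapsack_value a \<alpha> k z = Max (snd ` {s \<in> all_states a \<alpha> k. fst s \<le> z})"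
proof -
  have "{(\<Sum>i=1..k. \<alpha> i * x i) | x. x \<in> binary_vectors k \<and> (\<Sum>i=1..k. a i * x i) \<le> z}
      = snd ` {s \<in> all_states a \<alpha> k. fst s \<le> z}"
    unfolding all_states_image image_def by (auto simp del: One_nat_def)
  then show ?thesis
    by (simp add: knapsack_value_def)
qed

text \<open>
  Being dominated strictly lowers profit minus weight, so this difference is a potential that
  cannot increase forever in a finite set: a maximiser of it among the states at least as good as
  \<open>s\<close> in both coordinates is undominated in all of \<open>S\<close>.
\<close>

lemma undominated_state_covers:
  fixes S :: "(real \<times> real) set"
  assumes "finite S" "s \<in> S"
  obtains t where "t \<in> S" "\<not> (\<exists>u \<in> S. dominates u t)" "fst t \<le> fst s" "snd s \<le> snd t"
proof -
  define C where "C = {t \<in> S. fst t \<le> fst s \<and> snd s \<le> snd t}"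
  have "finite C" "s \<in> C"
    using assms by (simp_all add: C_def)
  then have "Max ((\<lambda>u. snd u - fst u) ` C) \<in> (\<lambda>u. snd u - fst u) ` C"
    by (intro Max_in) auto
  then obtain t where t: "t \<in> C" "snd t - fst t = Max ((\<lambda>u. snd u - fst u) ` C)"
    by force
  have max: "snd u - fst u \<le> snd t - fst t" if "u \<in> C" for u
    unfolding t(2) using \<open>finite C\<close> that by (intro Max_ge) simp_all
  have "\<not> dominates u t" if "u \<in> S" for u
  proof
    assume dom: "dominates u t"
    with that t(1) have "u \<in> C"
      by (auto simp: C_def dominates_def)
    with max[of u] dom show False
      by (auto simp: dominates_def)
  qed
  with t(1) show thesis
    by (intro that[of t]) (auto simp: C_def)
qed

lemma increasing_enumeration_mono:
  assumes "increasing_enumeration L m w p" "1 \<le> i" "i \<le> j" "j \<le> m"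
  shows "w i \<le> w j \<and> p i \<le> p j"
  using assms(3,4)
proof (induction j rule: dec_induct)
  case (step j)
  then have "j \<in> {1..<m}"
    using assms(2) by simp
  then have "w j < w (j + 1) \<and> p j < p (j + 1)"
    using assms(1) unfolding increasing_enumeration_def by blast
  with step show ?case
    by simp
qed simp

lemma dominance_list_covers:
  assumes enum: "increasing_enumeration (dominance_list a \<alpha> k) m w p"
    and "s \<in> all_states a \<alpha> k"
  obtains i where "i \<in> {1..m}" "w i \<le> fst s" "snd s \<le> p i"
proof -
  obtain t where "t \<in> dominance_list a \<alpha> k" "fst t \<le> fst s" "snd s \<le> snd t"
    using undominated_state_covers[OF finite_all_states assms(2)]
    unfolding dominance_list_def by blast
  moreover have "dominance_list a \<alpha> k = {(w j, p j) | j. j \<in> {1..m}}"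
    using enum unfolding increasing_enumeration_def by blast
  ultimately show thesis
    using that by fastforce
qed

text \<open>
  An optimal feasible state may itself be dominated, but the listed state covering it weighs no
  more, so it fits too; it therefore stands no later than \<open>j\<close> and earns at
  most \<open>p j\<close>. Taking \<open>j\<close> to be the last fitting index treats inner
  intervals and the final one uniformly.
\<close>

lemma knapsack_value_last_fitting:
  assumes enum: "increasing_enumeration (dominance_list a \<alpha> k) m w p"
    and j: "j \<in> {1..m}" "w j \<le> z"
    and last: "\<And>i. i \<in> {1..m} \<Longrightarrow> w i \<le> z \<Longrightarrow> i \<le> j"
  shows "knapsack_value a \<alpha> k z = p j"
  unfolding knapsack_value_all_states
proof (rule Max_eqI)
  show "finite (snd ` {s \<in> all_states a \<alpha> k. fst s \<le> z})"
    using finite_all_states by simp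
next
  have "(w j, p j) \<in> dominance_list a \<alpha> k"
    using enum j(1) unfolding increasing_enumeration_def by blast
  then show "p j \<in> snd ` {s \<in> all_states a \<alpha> k. fst s \<le> z}"
    using j(2) by (intro image_eqI[of _ _ "(w j, p j)"]) (simp_all add: dominance_list_def)
next
  fix q
  assume "q \<in> snd ` {s \<in> all_states a \<alpha> k. fst s \<le> z}"
  then obtain s where s: "s \<in> all_states a \<alpha> k" "fst s \<le> z" "q = snd s"
    by auto
  obtain i where i: "i \<in> {1..m}" "w i \<le> fst s" "snd s \<le> p i"
    using dominance_list_covers[OF enum s(1)] .
  with s last[of i] have "i \<le> j"
    by simp
  then have "p i \<le> p j"
    using increasing_enumeration_mono[OF enum] i(1) j(1) by simp
  with i s show "q \<le> p j"
    by simp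
qed

theorem theorem1:
  fixes n k m :: nat and a \<alpha> w p :: "nat \<Rightarrow> real" and b z :: real
  assumes "n \<ge> 1"
    and "\<And>i. i \<in> {1..n} \<Longrightarrow> a i \<in> \<rat>" and "b \<in> \<rat>"
    and "\<And>i. i \<in> {1..n} \<Longrightarrow> 0 < a i \<and> a i \<le> b"
    and "(\<Sum>i=1..n. a i) > b"
    and "k \<in> {1..n}"
    and "increasing_enumeration (dominance_list a \<alpha> k) m w p"
    and "z \<in> {0..b}"
  shows "((\<exists>j \<in> {1..<m}. z \<in> {w j..<w (j + 1)}) \<or> z \<in> {w m..b})
    \<and> (\<forall>j \<in> {1..<m}. z \<in> {w j..<w (j + 1)} \<longrightarrow> knapsack_value a \<alpha> k z = p j)
    \<and> (z \<in> {w m..b} \<longrightarrow> knapsack_value a \<alpha> k z = p m)"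
proof (intro conjI ballI impI)
  note enum = assms(7)
  \<comment> \<open>The state covering the empty packing makes the list nonempty and starts it at weight at most 0.\<close>
  obtain i0 where i0: "i0 \<in> {1..m}" "w i0 \<le> 0"
    using dominance_list_covers[OF enum zero_state] by auto
  show "(\<exists>j \<in> {1..<m}. z \<in> {w j..<w (j + 1)}) \<or> z \<in> {w m..b}"
  proof -
    define J where "J = {i \<in> {1..m}. w i \<le> z}"
    have "finite J" "J \<noteq> {}"
      using i0 assms(8) by (auto simp: J_def)
    then have max: "Max J \<in> J" "\<And>i. i \<in> J \<Longrightarrow> i \<le> Max J"
      by simp_all
    show ?thesis
    proof (cases "Max J = m")
      case True
      with max(1) assms(8) show ?thesis
        by (simp add: J_def)
    next
      case False
      with max(1) have Jm: "Max J \<in> {1..<m}"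
        by (simp add: J_def)
      have "Max J + 1 \<notin> J"
        using max(2)[of "Max J + 1"] by auto
      with Jm have "z < w (Max J + 1)"
        by (simp add: J_def)
      with max(1) Jm show ?thesis
        by (auto simp: J_def)
    qed
  qed
  show "knapsack_value a \<alpha> k z = p j" if j: "j \<in> {1..<m}" "z \<in> {w j..<w (j + 1)}" for j
  proof (rule knapsack_value_last_fitting[OF enum])
    fix i
    assume i: "i \<in> {1..m}" "w i \<le> z"
    show "i \<le> j"
    proof (rule ccontr)
      assume "\<not> i \<le> j"
      then have "w (j + 1) \<le> w i"
        using increasing_enumeration_mono[OF enum, of "j + 1" i] i by simp
      with i j show False
        by simp
    qed
  qed (use j in auto)
  show "knapsack_value a \<alpha> k z = p m" if "z \<in> {w m..b}"
    using that i0(1) by (intro knapsack_value_last_fitting[OF enum]) auto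
qed

end
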